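(* Let $X$ be a Type I, regular and strongly collectionwise Hausdorff space. Then a direction in $X$ cannot be discrete.
   Context: All spaces are Hausdorff (regular includes Hausdorff) and all functions are continuous unless otherwise specified. A space $X$ is Type I if $X=\bigcup_{\alpha<\omega_1}X_\alpha$ with each $X_\alpha$ open, $\overline{X_\alpha}$ Lindelöf, and $\overline{X_\alpha}\subset X_\beta$ whenever $\alpha<\beta$; Type I spaces are always assumed non-Lindelöf. A subset of a Type I space is bounded if it is contained in some $X_\alpha$, otherwise unbounded; a function into a Type I space is (un)bounded if its range is. Club means closed and unbounded. $\mathbb{L}_{\ge 0}$ is the closed long ray $\omega_1\times[0,1)$ with the lexicographic order topology (with $X_\alpha=[0,\alpha)$). A direction in a Type I space $X$ is a club $D\subset X$ such that for every continuous $f:X\to\mathbb{L}_{\ge 0}$, if $f$ is unbounded on $D$ then $f$ is unbounded on every club subset of $D$. A collection of subsets of a space is discrete if any point of the space has a neighborhood intersecting at most one element of the collection. A space is strongly collectionwise Hausdorff if for any closed discrete set $D$ there are open sets $U_x\ni x$ ($x\in D$) such that $\{U_x : x\in D\}$ is a (disjointly indexed) discrete collection. *)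

theory Defs
  imports "HOL-Analysis.Analysis" "HOL-Library.Countable_Set_Type"
begin

section \<open>The first uncountable ordinal\<close>

text \<open>
  \<^term>\<open>cardSuc natLeq\<close> is a well-order of least uncountable order type; its field, ordered by
  it, serves as \<open>\<omega>\<^sub>1\<close>.
\<close>

typedef omega1 = "Field (cardSuc natLeq)"
  using infinite_imp_nonempty[of "Field (cardSuc natLeq)"] cardSuc_finite[OF natLeq_Card_order]
  by (auto simp: Field_natLeq)

lemma cardSuc_natLeq_Well_order: "Well_order (cardSuc natLeq)"
  using cardSuc_Card_order[OF natLeq_Card_order] unfolding card_order_on_def by blast

instantiation omega1 :: wellorder
begin

definition less_eq_omega1 :: "omega1 \<Rightarrow> omega1 \<Rightarrow> bool" where
  "a \<le> b \<longleftrightarrow> (Rep_omega1 a, Rep_omega1 b) \<in> cardSuc natLeq"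

definition less_omega1 :: "omega1 \<Rightarrow> omega1 \<Rightarrow> bool" where
  "(a::omega1) < b \<longleftrightarrow> a \<le> b \<and> a \<noteq> b"

instance
proof
  note W = cardSuc_natLeq_Well_order[unfolded well_order_on_def linear_order_on_def
      partial_order_on_def preorder_on_def]
  have antisymm: "x = y" if "x \<le> y" "y \<le> x" for x y :: omega1
    using W that Rep_omega1_inject[of x y] unfolding less_eq_omega1_def antisym_def by blast
  have refl: "x \<le> x" for x :: omega1
    using W Rep_omega1[of x] unfolding less_eq_omega1_def refl_on_def by blast
  show "x < y \<longleftrightarrow> x \<le> y \<and> \<not> y \<le> x" for x y :: omega1
    using antisymm[of x y] refl[of x] by (auto simp: less_omega1_def)
  show "x \<le> x" for x :: omega1
    using refl .
  show "x \<le> z" if "x \<le> y" "y \<le> z" for x y z :: omega1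
    using W that unfolding less_eq_omega1_def trans_def by blast
  show "x = y" if "x \<le> y" "y \<le> x" for x y :: omega1
    using antisymm that .
  show "x \<le> y \<or> y \<le> x" for x y :: omega1
  proof (cases "x = y")
    case True
    then show ?thesis using refl by simp
  next
    case False
    then show ?thesis
      using W Rep_omega1[of x] Rep_omega1[of y] Rep_omega1_inject[of x y]
      unfolding less_eq_omega1_def total_on_def by blast
  qed
  show "P a" if step: "\<And>x. (\<And>y. y < x \<Longrightarrow> P y) \<Longrightarrow> P x" for P and a :: omega1
  proof -
    have "wf (inv_image (cardSuc natLeq - Id) Rep_omega1)"
      using W by (blast intro: wf_inv_image)
    moreover have "inv_image (cardSuc natLeq - Id) Rep_omega1 = {(x, y). x < y}"
      by (auto simp: less_omega1_def less_eq_omega1_def Rep_omega1_inject)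
    ultimately have "wf {(x, y :: omega1). x < y}" by simp
    then show ?thesis by (induction a rule: wf_induct_rule) (rule step, simp)
  qed
qed

end

lemma uncountable_omega1:
  includes cardinal_syntax
  shows "uncountable (UNIV :: omega1 set)"
proof
  assume "countable (UNIV :: omega1 set)"
  then have "countable (range Rep_omega1)" by (rule countable_image)
  then have "countable (Field (cardSuc natLeq))"
    using type_definition.Rep_range[OF type_definition_omega1] by simp
  then have "|Field (cardSuc natLeq)| \<le>o natLeq"
    by (simp add: countable_card_le_natLeq)
  then have "cardSuc natLeq \<le>o natLeq"
    using card_of_Field_ordIso[OF cardSuc_Card_order[OF natLeq_Card_order]]
      ordIso_ordLeq_trans ordIso_symmetric by blast
  then show False
    using cardSuc_greater[OF natLeq_Card_order] not_ordLess_ordLeq by blast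
qed

lemma countable_omega1_segment:
  includes cardinal_syntax
  shows "countable {..<a :: omega1}"
proof -
  let ?r = "cardSuc natLeq"
  have "|underS ?r (Rep_omega1 a)| <o |Field ?r|"
    using card_of_underS[OF cardSuc_Card_order[OF natLeq_Card_order] Rep_omega1]
      card_of_Field_ordIso[OF cardSuc_Card_order[OF natLeq_Card_order]]
      ordLess_ordIso_trans ordIso_symmetric by blast
  then have "|underS ?r (Rep_omega1 a)| <o ?r"
    using card_of_Field_ordIso[OF cardSuc_Card_order[OF natLeq_Card_order]]
      ordLess_ordIso_trans by blast
  then have "|underS ?r (Rep_omega1 a)| \<le>o natLeq"
    using cardSuc_ordLeq_ordLess[OF natLeq_Card_order card_of_Card_order] by blast
  then have "countable (underS ?r (Rep_omega1 a))"
    by (simp add: countable_card_le_natLeq)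
  moreover have "Rep_omega1 ` {..<a} \<subseteq> underS ?r (Rep_omega1 a)"
    by (auto simp: underS_def less_omega1_def less_eq_omega1_def Rep_omega1_inject)
  ultimately have "countable (Rep_omega1 ` {..<a})"
    by (rule countable_subset[rotated])
  then show ?thesis
    by (rule countable_image_inj_on) (simp add: inj_on_def Rep_omega1_inject)
qed

section \<open>The closed long ray\<close>

text \<open>A separate type is needed because pairs already carry the product topology.\<close>

typedef long_ray = "(UNIV :: omega1 set) \<times> {0..<1::real}"
  by (rule exI[of _ "(undefined, 0)"]) simp

instantiation long_ray :: linorder
begin

definition less_eq_long_ray :: "long_ray \<Rightarrow> long_ray \<Rightarrow> bool" where
  "x \<le> y \<longleftrightarrow> fst (Rep_long_ray x) < fst (Rep_long_ray y) \<or>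
     fst (Rep_long_ray x) = fst (Rep_long_ray y) \<and> snd (Rep_long_ray x) \<le> snd (Rep_long_ray y)"

definition less_long_ray :: "long_ray \<Rightarrow> long_ray \<Rightarrow> bool" where
  "x < y \<longleftrightarrow> fst (Rep_long_ray x) < fst (Rep_long_ray y) \<or>
     fst (Rep_long_ray x) = fst (Rep_long_ray y) \<and> snd (Rep_long_ray x) < snd (Rep_long_ray y)"

instance
  by standard
    (auto simp: less_eq_long_ray_def less_long_ray_def Rep_long_ray_inject[symmetric] prod_eq_iff)

end

instantiation long_ray :: linorder_topology
begin

definition open_long_ray :: "long_ray set \<Rightarrow> bool" where
  "open_long_ray = generate_topology (range (\<lambda>a. {..<a}) \<union> range (\<lambda>a. {a<..}))"

instance
  by standard (rule open_long_ray_def)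

end

definition long_ray_segment :: "omega1 \<Rightarrow> long_ray set" where
  "long_ray_segment \<alpha> = {..<Abs_long_ray (\<alpha>, 0)}"

section \<open>Type I spaces and directions\<close>

text \<open>
  The family \<open>U\<close> witnessing that a space is of Type I is kept explicit. Boundedness does not depend
  on the choice of the witness: if \<open>U\<close> and \<open>V\<close> are two witnesses, the Lindelof closure of each
  \<open>U \<alpha>\<close> is contained in some \<open>V \<beta>\<close>, and conversely.
\<close>

definition type_I_space :: "'a topology \<Rightarrow> (omega1 \<Rightarrow> 'a set) \<Rightarrow> bool" where
  "type_I_space X U \<longleftrightarrow>
     Hausdorff_space X \<and> \<not> Lindelof_space X \<and>
     topspace X = (\<Union>\<alpha>. U \<alpha>) \<and>
     (\<forall>\<alpha>. openin X (U \<alpha>)) \<and>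
     (\<forall>\<alpha>. Lindelof_space (subtopology X (X closure_of U \<alpha>))) \<and>
     (\<forall>\<alpha> \<beta>. \<alpha> < \<beta> \<longrightarrow> X closure_of U \<alpha> \<subseteq> U \<beta>)"

definition bounded_wrt :: "(omega1 \<Rightarrow> 'a set) \<Rightarrow> 'a set \<Rightarrow> bool" where
  "bounded_wrt U S \<longleftrightarrow> (\<exists>\<alpha>. S \<subseteq> U \<alpha>)"

definition club :: "'a topology \<Rightarrow> (omega1 \<Rightarrow> 'a set) \<Rightarrow> 'a set \<Rightarrow> bool" where
  "club X U C \<longleftrightarrow> closedin X C \<and> \<not> bounded_wrt U C"

definition direction :: "'a topology \<Rightarrow> (omega1 \<Rightarrow> 'a set) \<Rightarrow> 'a set \<Rightarrow> bool" where
  "direction X U D \<longleftrightarrow>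
     club X U D \<and>
     (\<forall>f :: 'a \<Rightarrow> long_ray.
        continuous_map X euclidean f \<and> \<not> bounded_wrt long_ray_segment (f ` D) \<longrightarrow>
        (\<forall>C. club X U C \<and> C \<subseteq> D \<longrightarrow> \<not> bounded_wrt long_ray_segment (f ` C)))"

section \<open>Strong collectionwise Hausdorffness\<close>

definition discrete_subset :: "'a topology \<Rightarrow> 'a set \<Rightarrow> bool" where
  "discrete_subset X D \<longleftrightarrow> D \<subseteq> topspace X \<and> subtopology X D = discrete_topology D"

definition discrete_collection :: "'a topology \<Rightarrow> 'a set set \<Rightarrow> bool" where
  "discrete_collection X \<C> \<longleftrightarrow>
     (\<forall>p \<in> topspace X. \<exists>W. openin X W \<and> p \<in> W \<and>
        (\<forall>A \<in> \<C>. \<forall>B \<in> \<C>. W \<inter> A \<noteq> {} \<and> W \<inter> B \<noteq> {} \<longrightarrow> A = B))"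

definition strongly_collectionwise_Hausdorff :: "'a topology \<Rightarrow> bool" where
  "strongly_collectionwise_Hausdorff X \<longleftrightarrow>
     Hausdorff_space X \<and>
     (\<forall>D. closedin X D \<and> discrete_subset X D \<longrightarrow>
        (\<exists>U. (\<forall>x \<in> D. openin X (U x) \<and> x \<in> U x) \<and>
             disjoint_family_on U D \<and> discrete_collection X (U ` D)))"

end

theory Submission
  imports Defs
begin

text \<open>
  Suppose that the direction \<open>D\<close> is discrete. Split \<open>D\<close> into two unbounded pieces \<open>E\<close> and \<open>D - E\<close>;
  both are closed. Strong collectionwise Hausdorffness expands \<open>D\<close> to a discrete family of open sets
  \<open>V x\<close>, and since a Type I regular space is completely regular, each \<open>x \<in> E\<close> carries a function
  into the long ray that vanishes outside \<open>V x\<close> and sends \<open>x\<close> to the least \<open>\<alpha>\<close> with \<open>x \<in> U \<alpha>\<close>.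
  These functions add up to a continuous function that is unbounded on \<open>E\<close> and zero on the club
  \<open>D - E\<close>.
\<close>

section \<open>Countable and uncountable sets of countable ordinals\<close>

lemma countable_omega1_atMost: "countable {..a :: omega1}"
  using countable_omega1_segment[of a] by (simp flip: ivl_disj_un_singleton(2))

text \<open>Countably many countable initial segments cannot cover \<open>omega1\<close>; a point
  outside their union lies strictly above all of \<open>R\<close>.\<close>

lemma countable_omega1_bounded:
  fixes R :: "omega1 set"
  assumes "countable R"
  obtains b where "\<And>r. r \<in> R \<Longrightarrow> r < b"
proof -
  have "countable (\<Union>r\<in>R. {..r})"
    using assms countable_omega1_atMost by blast
  then have "(\<Union>r\<in>R. {..r}) \<noteq> UNIV"
    using uncountable_omega1 by metis
  then obtain b where "b \<notin> (\<Union>r\<in>R. {..r})"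
    by blast
  then show ?thesis
    using that[of b] by force
qed

text \<open>An infinite set is equinumerous with two disjoint copies of itself; a bijection carries
  the copies to disjoint uncountable parts of \<open>R\<close>.\<close>

lemma uncountable_split:
  assumes "uncountable R"
  obtains A where "A \<subseteq> R" "uncountable A" "uncountable (R - A)"
proof -
  have "\<not> finite R"
    using assms countable_finite by blast
  then have "(card_of (R <+> R), card_of R) \<in> ordIso"
    by (intro card_of_Plus_infinite1 card_of_mono1 subset_refl)
  then obtain h where h: "bij_betw h (R <+> R) R"
    using card_of_ordIso by blast
  have inj: "inj_on h (R <+> R)" and im: "h ` (R <+> R) = R"
    using h by (auto simp: bij_betw_def)
  let ?A = "h ` Inl ` R" and ?B = "h ` Inr ` R"
  have "inj_on h (Inl ` R)" "inj_on h (Inr ` R)"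
    using inj by (auto intro: inj_on_subset)
  then have unc: "uncountable ?A" "uncountable ?B"
    using assms by (metis countable_image_inj_on inj_Inl inj_on_subset subset_UNIV)
      (metis \<open>inj_on h (Inr ` R)\<close> assms countable_image_inj_on inj_Inr inj_on_subset subset_UNIV)
  have "?A \<subseteq> R"
    using im by blast
  moreover have "?B \<subseteq> R - ?A"
    using im inj by (fastforce dest: inj_onD)
  ultimately show ?thesis
    using that unc countable_subset by metis
qed

section \<open>Paths in the long ray\<close>

definition long_ray_zero :: long_ray where
  \<comment> \<open>\<open>LEAST \<alpha>. True\<close> is the first ordinal, so this is the
    endpoint of the ray.\<close>
  "long_ray_zero = Abs_long_ray (LEAST \<alpha>. True, 0)"

lemma Rep_long_ray_Abs: "0 \<le> t \<Longrightarrow> t < 1 \<Longrightarrow> Rep_long_ray (Abs_long_ray (\<alpha>, t)) = (\<alpha>, t)"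
  by (rule Abs_long_ray_inverse) simp

lemma snd_Rep_long_ray: "0 \<le> snd (Rep_long_ray x)" "snd (Rep_long_ray x) < 1"
  using Rep_long_ray[of x] by auto

lemma long_ray_zero_le: "long_ray_zero \<le> x"
  using snd_Rep_long_ray(1)[of x] Least_le[of "\<lambda>_. True" "fst (Rep_long_ray x)"]
  by (auto simp: long_ray_zero_def less_eq_long_ray_def Rep_long_ray_Abs)

text \<open>The inverse is an order isomorphism from \<open>S\<close> onto \<open>{..a}\<close>, so
  a ray with endpoint \<open>b \<le> a\<close> pulls back to the trace on \<open>S\<close> of the
  ray with endpoint \<open>h b\<close>. This makes paths out of a strictly monotone
  coordinate.\<close>

lemma continuous_on_inv_into_strict_mono:
  fixes h :: "'a::linorder_topology \<Rightarrow> 'b::linorder_topology"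
  assumes mono: "strict_mono_on {..a} h" and img: "h ` {..a} = S"
  shows "continuous_on S (inv_into {..a} h)"
  unfolding continuous_on_def
proof (intro ballI order_tendstoI)
  let ?g = "inv_into {..a} h"
  have g: "?g s \<le> a" "h (?g s) = s" if "s \<in> S" for s
    using that inv_into_into[of s h "{..a}"] f_inv_into_f[of s h "{..a}"] img by auto
  have less: "h x < h y \<longleftrightarrow> x < y" if "x \<le> a" "y \<le> a" for x y
    using strict_mono_on_less[OF mono] that by simp
  fix s assume s: "s \<in> S"
  {
    fix b assume b: "b < ?g s"
    then have "h b < s"
      using g[OF s] less[of b "?g s"] by simp
    then have "eventually (\<lambda>t. h b < t) (at s within S)"
      by (intro order_tendstoD[OF tendsto_ident_at])
    then show "eventually (\<lambda>t. b < ?g t) (at s within S)"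
      unfolding eventually_at_filter
    proof eventually_elim
      case (elim t)
      then show ?case
        using g[of t] g[OF s] less[of b "?g t"] b by fastforce
    qed
  }
  {
    fix b assume b: "?g s < b"
    show "eventually (\<lambda>t. ?g t < b) (at s within S)"
    proof (cases "b \<le> a")
      case True
      then have "s < h b"
        using g[OF s] less[of "?g s" b] b by simp
      then have "eventually (\<lambda>t. t < h b) (at s within S)"
        by (intro order_tendstoD[OF tendsto_ident_at])
      then show ?thesis
        unfolding eventually_at_filter
      proof eventually_elim
        case (elim t)
        then show ?case
          using g[of t] less[of "?g t" b] True by fastforce
      qed
    next
      case False
      \<comment> \<open>All values of the inverse are at most \<open>a\<close>, hence below
        \<open>b\<close>.\<close>
      then show ?thesis
        unfolding eventually_at_filter using g by (intro always_eventually) fastforce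
    qed
  }
qed

text \<open>An injective enumeration assigns distinct powers of 1/2 to the points, so a geometric
  series dominates.\<close>

lemma countable_positive_summable:
  assumes "countable A"
  obtains w :: "'a \<Rightarrow> real" where "\<And>x. x \<in> A \<Longrightarrow> 0 < w x" "w summable_on A"
proof
  let ?w = "\<lambda>x. (1 / 2 :: real) ^ to_nat_on A x"
  show "0 < ?w x" for x
    by simp
  have "(\<lambda>n. (1 / 2 :: real) ^ n) summable_on UNIV"
    by (rule norm_summable_imp_summable_on) (simp add: summable_geometric)
  then have "(\<lambda>n. (1 / 2 :: real) ^ n) summable_on to_nat_on A ` A"
    by (rule summable_on_subset) simp
  then show "?w summable_on A"
    using inj_on_to_nat_on[OF assms] by (simp add: summable_on_reindex o_def)
qed

text \<open>
  The segment below \<open>(\<alpha>, 0)\<close> is coordinatised by giving the interval over each ordinal \<open>\<beta> < \<alpha>\<close> a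
  length \<open>w \<beta>\<close>, with finite total length.
\<close>

lemma long_ray_path:
  obtains g :: "real \<Rightarrow> long_ray" where
    "continuous_on {0..1} g" "g 0 = long_ray_zero" "g 1 = Abs_long_ray (\<alpha>, 0)"
proof -
  obtain w :: "omega1 \<Rightarrow> real" where
    w: "\<And>\<beta>. \<beta> \<le> \<alpha> \<Longrightarrow> 0 < w \<beta>" and sum_w: "w summable_on {..\<alpha>}"
    using countable_positive_summable[OF countable_omega1_atMost[of \<alpha>]] by auto
  \<comment> \<open>\<open>S \<beta>\<close> is the total length before the interval over \<beta>,
    and \<open>h x\<close> is the length of the segment below \<open>x\<close>.\<close>
  define S where "S \<beta> = infsum w {..<\<beta>}" for \<beta>
  define h where "h x = S (fst (Rep_long_ray x)) + snd (Rep_long_ray x) * w (fst (Rep_long_ray x))"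
    for x
  let ?a = "Abs_long_ray (\<alpha>, 0)"
  have summ: "w summable_on A" if "A \<subseteq> {..\<alpha>}" for A
    using summable_on_subset[OF sum_w that] .
  have mono: "infsum w A \<le> infsum w B" if "A \<subseteq> B" "B \<subseteq> {..\<alpha>}" for A B
    using that w by (intro infsum_mono2 summ) (auto intro: less_imp_le)
  have S_atMost: "infsum w {..\<beta>} = S \<beta> + w \<beta>" if "\<beta> \<le> \<alpha>" for \<beta>
  proof -
    have "w summable_on {..<\<beta>}"
      using that by (intro summ) auto
    then show ?thesis
      using infsum_insert[of w "{..<\<beta>}" \<beta>] unfolding S_def
      by (simp add: ivl_disj_un_singleton(2)[symmetric])
  qed
  have S_step: "S \<beta> + w \<beta> \<le> S \<gamma>" if "\<beta> < \<gamma>" "\<gamma> \<le> \<alpha>" for \<beta> \<gamma>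
    using S_atMost[of \<beta>] mono[of "{..\<beta>}" "{..<\<gamma>}"] that unfolding S_def by force
  have S_nonneg: "0 \<le> S \<beta>" if "\<beta> \<le> \<alpha>" for \<beta>
    using that w unfolding S_def by (intro infsum_nonneg) (auto intro!: less_imp_le)
  \<comment> \<open>This excludes gaps in the range of \<open>h\<close>, at limit ordinals in
    particular: a finite nonempty set of ordinals below \<gamma> has a maximum below \<gamma>, so
    its sum is controlled by a single earlier stage.\<close>
  have S_le: "S \<gamma> \<le> s" if "\<gamma> \<le> \<alpha>" "0 \<le> s" and *: "\<And>\<beta>. \<beta> < \<gamma> \<Longrightarrow> S \<beta> + w \<beta> \<le> s" for \<gamma> s
    unfolding S_def
  proof (rule infsum_le_finite_sums)
    show "w summable_on {..<\<gamma>}"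
      using that by (intro summ) auto
    fix F assume F: "finite F" "F \<subseteq> {..<\<gamma>}"
    show "sum w F \<le> s"
    proof (cases "F = {}")
      case False
      let ?m = "Max F"
      have m: "?m < \<gamma>" "F \<subseteq> {..?m}"
        using False F by auto
      have "sum w F \<le> infsum w {..?m}"
        using m that w F by (intro finite_sum_le_infsum summ) (auto intro!: less_imp_le)
      also have "\<dots> \<le> s"
        using S_atMost[of ?m] *[OF m(1)] m that by simp
      finally show ?thesis .
    qed (use that in simp)
  qed
  have a: "Rep_long_ray ?a = (\<alpha>, 0)"
    by (simp add: Rep_long_ray_Abs)
  have smono: "strict_mono_on {..?a} h"
  proof (rule strict_mono_onI)
    fix x y assume "x \<in> {..?a}" "y \<in> {..?a}" and xy: "x < y"
    then have le: "fst (Rep_long_ray x) \<le> \<alpha>" "fst (Rep_long_ray y) \<le> \<alpha>"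
      by (auto simp: less_eq_long_ray_def a)
    note t = snd_Rep_long_ray
    show "h x < h y"
    proof (cases "fst (Rep_long_ray x) < fst (Rep_long_ray y)")
      case True
      have "h x < S (fst (Rep_long_ray x)) + w (fst (Rep_long_ray x))"
        using t(2)[of x] w[OF le(1)] unfolding h_def by simp
      also have "\<dots> \<le> S (fst (Rep_long_ray y))"
        using S_step[OF True le(2)] .
      also have "\<dots> \<le> h y"
        using t(1)[of y] w[OF le(2)] unfolding h_def by simp
      finally show ?thesis .
    next
      case False
      then show ?thesis
        using xy w[OF le(1)] unfolding h_def less_long_ray_def by auto
    qed
  qed
  have img: "h ` {..?a} = {0..S \<alpha>}"
  proof (intro equalityI subsetI)
    fix s assume "s \<in> h ` {..?a}"
    then obtain x where x: "x \<le> ?a" "s = h x"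
      by auto
    then have "fst (Rep_long_ray x) \<le> \<alpha>"
      by (auto simp: less_eq_long_ray_def a)
    then have "0 \<le> h x"
      unfolding h_def using snd_Rep_long_ray(1)[of x] S_nonneg w by (simp add: less_imp_le)
    moreover have "h x \<le> h ?a"
      using x strict_mono_on_leD[OF smono, of x ?a] by simp
    moreover have "h ?a = S \<alpha>"
      by (simp add: h_def a)
    ultimately show "s \<in> {0..S \<alpha>}"
      using x by simp
  next
    fix s assume s: "s \<in> {0..S \<alpha>}"
    show "s \<in> h ` {..?a}"
    proof (cases "s = S \<alpha>")
      case True
      then have "h ?a = s"
        by (simp add: h_def a)
      then show ?thesis
        by blast
    next
      case False
      \<comment> \<open>The interval containing \<open>s\<close> is the first one ending beyond
        \<open>s\<close>. If there were none, \<open>S_le\<close> would give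
        \<open>S \<alpha> \<le> s\<close>; minimality and \<open>S_le\<close> show that the first
        one starts at or before \<open>s\<close>.\<close>
      define P where "P \<beta> \<longleftrightarrow> \<beta> < \<alpha> \<and> s < S \<beta> + w \<beta>" for \<beta>
      have "\<exists>\<beta>. P \<beta>"
        using S_le[of \<alpha> s] s False unfolding P_def by force
      then have P: "P (LEAST \<beta>. P \<beta>)"
        by (rule LeastI_ex)
      define \<beta> where "\<beta> = (LEAST \<beta>. P \<beta>)"
      have \<beta>: "\<beta> < \<alpha>" "s < S \<beta> + w \<beta>"
        using P unfolding \<beta>_def P_def by auto
      have "S \<gamma> + w \<gamma> \<le> s" if "\<gamma> < \<beta>" for \<gamma>
        using not_less_Least[of \<gamma> P] that \<beta>(1) unfolding P_def \<beta>_def by force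
      then have S: "S \<beta> \<le> s"
        using S_le[of \<beta> s] \<beta>(1) s by simp
      define t where "t = (s - S \<beta>) / w \<beta>"
      have "0 < w \<beta>"
        using w \<beta> by simp
      then have t: "0 \<le> t" "t < 1" "S \<beta> + t * w \<beta> = s"
        using S \<beta> unfolding t_def by (auto simp: field_simps)
      then have "h (Abs_long_ray (\<beta>, t)) = s" "Abs_long_ray (\<beta>, t) \<le> ?a"
        using \<beta> by (auto simp: h_def less_eq_long_ray_def Rep_long_ray_Abs)
      then show ?thesis
        by blast
    qed
  qed
  let ?k = "inv_into {..?a} h"
  have k: "?k (h x) = x" if "x \<le> ?a" for x
    using that strict_mono_on_imp_inj_on[OF smono] by (simp add: inv_into_f_f)
  have "{..<LEAST \<alpha> :: omega1. True} = {}"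
    using not_less_Least by blast
  then have h0: "h long_ray_zero = 0"
    by (simp add: h_def long_ray_zero_def Rep_long_ray_Abs S_def)
  have h1: "h ?a = S \<alpha>"
    by (simp add: h_def a)
  show ?thesis
  proof
    \<comment> \<open>Rescaling by \<open>S \<alpha>\<close> also covers the first ordinal, where
      \<open>S \<alpha> = 0\<close> and the path is constant.\<close>
    have "continuous_on {0..S \<alpha>} ?k"
      using continuous_on_inv_into_strict_mono[OF smono img] .
    moreover have "(*) (S \<alpha>) ` {0..1} \<subseteq> {0..S \<alpha>}"
      using S_nonneg[of \<alpha>] by (auto simp: mult_left_le)
    ultimately show "continuous_on {0..1} (\<lambda>s. ?k (S \<alpha> * s))"
      using continuous_on_compose2[OF _ continuous_on_mult_left[OF continuous_on_id]] by blast
    show "?k (S \<alpha> * 0) = long_ray_zero"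
      using k[OF long_ray_zero_le] h0 by simp
    show "?k (S \<alpha> * 1) = ?a"
      using k[of ?a] h1 by simp
  qed
qed

section \<open>Functions on Type I spaces\<close>

lemma type_I_space_mono:
  assumes "type_I_space X U" "\<alpha> \<le> \<beta>"
  shows "U \<alpha> \<subseteq> U \<beta>"
proof (cases "\<alpha> = \<beta>")
  case False
  then have "X closure_of U \<alpha> \<subseteq> U \<beta>"
    using assms unfolding type_I_space_def by simp
  moreover have "U \<alpha> \<subseteq> X closure_of U \<alpha>"
    using assms unfolding type_I_space_def by (meson closure_of_subset openin_subset)
  ultimately show ?thesis
    by blast
qed simp

text \<open>The closure of some \<open>U \<alpha>\<close> containing \<open>x\<close> is regular and
  Lindelof, hence normal, so Urysohn's lemma applies inside it. The function is made to vanish off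
  \<open>V \<inter> U \<alpha>\<close>, hence on the frontier of \<open>U \<alpha>\<close>, and so
  extends continuously by 0.\<close>

lemma type_I_regular_separation:
  assumes X: "type_I_space X U" "regular_space X" and V: "openin X V" "x \<in> V"
  obtains u :: "'a \<Rightarrow> real" where "continuous_map X (top_of_set {0..1}) u" "u x = 1"
    "\<And>z. z \<in> topspace X - V \<Longrightarrow> u z = 0"
proof -
  have Haus: "Hausdorff_space X" and opn: "\<And>\<alpha>. openin X (U \<alpha>)"
    and Lind: "\<And>\<alpha>. Lindelof_space (subtopology X (X closure_of U \<alpha>))"
    and un: "topspace X = (\<Union>\<alpha>. U \<alpha>)"
    using X(1) unfolding type_I_space_def by auto
  have xX: "x \<in> topspace X"
    using V openin_subset by blast
  then obtain \<alpha> where \<alpha>: "x \<in> U \<alpha>"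
    using un by blast
  let ?K = "X closure_of U \<alpha>"
  let ?Y = "subtopology X ?K"
  have UK: "U \<alpha> \<subseteq> ?K" and KX: "?K \<subseteq> topspace X"
    by (simp_all add: closure_of_subset closure_of_subset_topspace opn openin_subset)
  have "regular_space ?Y"
    by (rule regular_space_subtopology[OF X(2)])
  then have normal: "normal_space ?Y"
    using Lind by (rule regular_Lindelof_imp_normal_space)
  have W: "openin X (V \<inter> U \<alpha>)"
    using V opn by blast
  have c1: "closedin ?Y (?K - V \<inter> U \<alpha>)"
    using W by (metis closedin_closure_of closedin_diff closedin_subset_topspace Diff_subset)
  have c2: "closedin ?Y {x}"
    using Haus xX \<alpha> UK
    by (intro closedin_subset_topspace) (auto simp: Hausdorff_imp_t1_space closedin_t1_singleton)
  have "disjnt (?K - V \<inter> U \<alpha>) {x}"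
    using V \<alpha> by (simp add: disjnt_def)
  then obtain v where v: "continuous_map ?Y (top_of_set {0..1::real}) v"
      "v ` (?K - V \<inter> U \<alpha>) \<subseteq> {0}" "v ` {x} \<subseteq> {1}"
    using Urysohn_lemma[OF normal c1 c2, of 0 1] by auto
  define u where "u z = (if z \<in> U \<alpha> then v z else 0)" for z
  have "continuous_map X (top_of_set {0..1}) u"
    unfolding u_def
  proof (rule continuous_map_cases_alt)
    have "{z \<in> topspace X. z \<in> U \<alpha>} = U \<alpha>"
      using opn openin_subset by blast
    then show "continuous_map (subtopology X (X closure_of {z \<in> topspace X. z \<in> U \<alpha>}))
        (top_of_set {0..1}) v"
      using v(1) by simp
    show "v z = 0" if "z \<in> X frontier_of {z \<in> topspace X. z \<in> U \<alpha>}" for z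
    proof -
      have "z \<in> ?K - U \<alpha>"
        using that opn[of \<alpha>] \<open>{z \<in> topspace X. z \<in> U \<alpha>} = U \<alpha>\<close>
        by (simp add: frontier_of_def interior_of_openin)
      then show ?thesis
        using v(2) by blast
    qed
  qed simp
  moreover have "u x = 1"
    using v(3) \<alpha> by (simp add: u_def)
  moreover have "u z = 0" if "z \<in> topspace X - V" for z
    using that v(2) UK by (auto simp: u_def)
  ultimately show ?thesis
    using that by blast
qed

text \<open>A real-valued bump followed by a path from the endpoint of the ray to the prescribed
  value does this.\<close>

lemma type_I_regular_long_ray_bump:
  assumes "type_I_space X U" "regular_space X" "openin X V" "x \<in> V"
  obtains f where "continuous_map X euclidean f" "f x = Abs_long_ray (\<alpha>, 0)"
    "\<And>z. z \<in> topspace X - V \<Longrightarrow> f z = long_ray_zero"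
proof -
  obtain u :: "'a \<Rightarrow> real" where u: "continuous_map X (top_of_set {0..1}) u" "u x = 1"
      "\<And>z. z \<in> topspace X - V \<Longrightarrow> u z = 0"
    using type_I_regular_separation[OF assms] by blast
  obtain g :: "real \<Rightarrow> long_ray" where
    g: "continuous_on {0..1} g" "g 0 = long_ray_zero" "g 1 = Abs_long_ray (\<alpha>, 0)"
    using long_ray_path by blast
  have "continuous_map X euclidean (g \<circ> u)"
    using u(1) g(1) by (intro continuous_map_compose[of _ "top_of_set {0..1}"]) simp_all
  then show ?thesis
    using that[of "g \<circ> u"] u g by simp
qed

text \<open>Each point has a neighborhood meeting at most one set of the family. There
  \<open>F\<close> coincides with a single \<open>f x\<close> or with the constant \<open>c\<close>,
  and continuity is local.\<close>

lemma continuous_map_paste_discrete: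
  assumes disc: "discrete_collection X (V ` E)" and disj: "disjoint_family_on V E"
    and cont: "\<And>x. x \<in> E \<Longrightarrow> continuous_map X Y (f x)" and c: "c \<in> topspace Y"
    and outside: "\<And>x z. x \<in> E \<Longrightarrow> z \<in> topspace X - V x \<Longrightarrow> f x z = c"
  obtains F where "continuous_map X Y F" "\<And>x z. x \<in> E \<Longrightarrow> z \<in> V x \<Longrightarrow> F z = f x z"
    "\<And>z. z \<notin> (\<Union>x\<in>E. V x) \<Longrightarrow> F z = c"
proof -
  define F where
    "F z = (if z \<in> (\<Union>x\<in>E. V x) then f (SOME x. x \<in> E \<and> z \<in> V x) z else c)" for z
  have F1: "F z = f x z" if "x \<in> E" "z \<in> V x" for x z
  proof -
    \<comment> \<open>Disjointness makes the chosen index unique.\<close>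
    have "(SOME x. x \<in> E \<and> z \<in> V x) = x"
      using that disj by (intro some_equality) (auto simp: disjoint_family_on_def)
    then show ?thesis
      using that by (auto simp: F_def)
  qed
  have F2: "F z = c" if "z \<notin> (\<Union>x\<in>E. V x)" for z
    using that by (simp add: F_def)
  have loc: "\<exists>W f'. openin X W \<and> p \<in> W \<and> continuous_map X Y f' \<and> (\<forall>z\<in>W. F z = f' z)"
    if p: "p \<in> topspace X" for p
  proof -
    obtain W where "openin X W \<and> p \<in> W \<and>
        (\<forall>A \<in> V ` E. \<forall>B \<in> V ` E. W \<inter> A \<noteq> {} \<and> W \<inter> B \<noteq> {} \<longrightarrow> A = B)"
      using bspec[OF disc[unfolded discrete_collection_def] p] by (rule exE)
    then have W: "openin X W" "p \<in> W"
      \<comment> \<open>Discreteness identifies the sets, not their indices; this suffices, since a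
        point of \<open>W\<close> in any member of the family then lies in
        \<open>V x\<close>.\<close>
      and meet: "\<And>x y. x \<in> E \<Longrightarrow> y \<in> E \<Longrightarrow> W \<inter> V x \<noteq> {} \<Longrightarrow> W \<inter> V y \<noteq> {} \<Longrightarrow> V x = V y"
      by simp_all
    show ?thesis
    proof (cases "\<exists>x\<in>E. W \<inter> V x \<noteq> {}")
      case True
      then obtain x where x: "x \<in> E" "W \<inter> V x \<noteq> {}"
        by blast
      have "F z = f x z" if z: "z \<in> W" for z
      proof (cases "z \<in> V x")
        case False
        have "z \<notin> (\<Union>x\<in>E. V x)"
          using meet[OF x(1) _ x(2)] z False by blast
        moreover have "z \<in> topspace X"
          using W(1) z openin_subset by blast
        ultimately show ?thesis
          using F2 outside[OF x(1)] False by simp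
      qed (use F1 x in simp)
      then show ?thesis
        using W cont[OF x(1)] by blast
    next
      case False
      then have "F z = c" if "z \<in> W" for z
        using F2 that by blast
      moreover have "continuous_map X Y (\<lambda>_. c)"
        using c by simp
      ultimately show ?thesis
        using W by blast
    qed
  qed
  then obtain W f' where Wf: "\<And>p. p \<in> topspace X \<Longrightarrow> openin X (W p) \<and> p \<in> W p \<and>
      continuous_map X Y (f' p) \<and> (\<forall>z\<in>W p. F z = f' p z)"
    by metis
  have "continuous_map X Y F"
  \<comment> \<open>The local pieces agree on overlaps because each coincides with \<open>F\<close>
    on its neighborhood.\<close>
  proof (rule pasting_lemma[where I = "topspace X" and T = W and f = f'])
    show "f' i x = f' j x"
      if "i \<in> topspace X" "j \<in> topspace X" "x \<in> topspace X \<inter> W i \<inter> W j" for i j x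
      using that Wf by (metis IntE)
  qed (use Wf in \<open>auto intro: continuous_map_from_subtopology\<close>)
  then show ?thesis
    using that F1 F2 by blast
qed

section \<open>Closed discrete sets\<close>

text \<open>Every subset is closed in a discrete subspace, and closedness passes up from a closed
  subspace. This makes the discarded half of the direction a club.\<close>

lemma closedin_subset_of_closed_discrete:
  assumes "closedin X D" "discrete_subset X D" "C \<subseteq> D"
  shows "closedin X C"
proof -
  have "closedin (subtopology X D) C"
    using assms by (simp add: discrete_subset_def)
  then show ?thesis
    using assms(1) closedin_trans_full by blast
qed

text \<open>Splitting the ranks \<open>r x\<close> instead of the points guarantees unboundedness: a
  bounded set has only countably many ranks, whereas it may have uncountably many points.\<close>

lemma unbounded_split:
  assumes X: "type_I_space X U" and D: "D \<subseteq> topspace X" "\<not> bounded_wrt U D"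
  obtains E where "E \<subseteq> D" "\<not> bounded_wrt U E" "\<not> bounded_wrt U (D - E)"
proof -
  define r where "r x = (LEAST \<alpha>. x \<in> U \<alpha>)" for x
  have "topspace X = (\<Union>\<alpha>. U \<alpha>)"
    using X unfolding type_I_space_def by simp
  then have r: "x \<in> U (r x)" if "x \<in> D" for x
    using that D(1) unfolding r_def by (metis LeastI UN_E subsetD)
  have unbounded: "\<not> bounded_wrt U E" if "uncountable (r ` E)" for E
  proof
    assume "bounded_wrt U E"
    then obtain \<alpha> where "E \<subseteq> U \<alpha>"
      unfolding bounded_wrt_def by blast
    then have "r ` E \<subseteq> {..\<alpha>}"
      unfolding r_def by (auto intro: Least_le)
    then show False
      using that countable_omega1_atMost countable_subset by blast
  qed
  have "uncountable (r ` D)"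
  proof
    assume "countable (r ` D)"
    then obtain b where "\<And>x. x \<in> D \<Longrightarrow> r x < b"
      using countable_omega1_bounded by (metis imageI)
    then have "D \<subseteq> U b"
      using r type_I_space_mono[OF X] by (meson less_imp_le subsetD subsetI)
    then show False
      using D(2) unfolding bounded_wrt_def by blast
  qed
  then obtain A where A: "A \<subseteq> r ` D" "uncountable A" "uncountable (r ` D - A)"
    by (rule uncountable_split)
  define E where "E = {x \<in> D. r x \<in> A}"
  have "r ` E = A" "r ` (D - E) = r ` D - A"
    using A(1) unfolding E_def by auto
  then show ?thesis
    using that[of E] unbounded[of E] unbounded[of "D - E"] A(2,3) by (auto simp: E_def)
qed

section \<open>Contradiction from a discrete direction\<close>

theorem lemma7p3:
  fixes X :: "'a topology" and U :: "omega1 \<Rightarrow> 'a set" and D :: "'a set"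
  assumes "type_I_space X U"
    and "regular_space X"
    and "strongly_collectionwise_Hausdorff X"
    and "direction X U D"
  shows "\<not> discrete_subset X D"
proof
  assume disc: "discrete_subset X D"
  have clo: "closedin X D" and unb: "\<not> bounded_wrt U D"
    using assms(4) unfolding direction_def club_def by auto
  have DX: "D \<subseteq> topspace X"
    using clo closedin_subset by blast
  obtain V where V: "\<And>x. x \<in> D \<Longrightarrow> openin X (V x)" "\<And>x. x \<in> D \<Longrightarrow> x \<in> V x"
    "disjoint_family_on V D" "discrete_collection X (V ` D)"
    using assms(3) clo disc unfolding strongly_collectionwise_Hausdorff_def by blast
  obtain E where E: "E \<subseteq> D" "\<not> bounded_wrt U E" "\<not> bounded_wrt U (D - E)"
    using unbounded_split[OF assms(1) DX unb] by blast
  define r where "r x = (LEAST \<alpha>. x \<in> U \<alpha>)" for x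
  have "topspace X = (\<Union>\<alpha>. U \<alpha>)"
    using assms(1) unfolding type_I_space_def by simp
  then have r: "x \<in> U (r x)" if "x \<in> D" for x
    using that DX unfolding r_def by (metis LeastI UN_E subsetD)
  have "\<exists>f. continuous_map X euclidean f \<and> f x = Abs_long_ray (r x, 0) \<and>
      (\<forall>z \<in> topspace X - V x. f z = long_ray_zero)" if "x \<in> E" for x
  proof -
    have "x \<in> D"
      using that E(1) by blast
    then show ?thesis
      using type_I_regular_long_ray_bump[OF assms(1,2) V(1,2)] by metis
  qed
  then obtain f where f: "\<And>x. x \<in> E \<Longrightarrow> continuous_map X euclidean (f x)"
    "\<And>x. x \<in> E \<Longrightarrow> f x x = Abs_long_ray (r x, 0)"
    "\<And>x z. x \<in> E \<Longrightarrow> z \<in> topspace X - V x \<Longrightarrow> f x z = long_ray_zero"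
    by metis
  \<comment> \<open>Only the sets over \<open>E\<close> enter the pasting, which leaves
    \<open>F\<close> at the endpoint of the ray on \<open>D - E\<close>.\<close>
  have "discrete_collection X (V ` E)"
    using V(4) E(1) unfolding discrete_collection_def by (meson image_mono subsetD)
  moreover have "disjoint_family_on V E"
    using V(3) E(1) by (rule disjoint_family_on_mono[rotated])
  ultimately obtain F where F: "continuous_map X euclidean F"
    "\<And>x z. x \<in> E \<Longrightarrow> z \<in> V x \<Longrightarrow> F z = f x z"
    "\<And>z. z \<notin> (\<Union>x\<in>E. V x) \<Longrightarrow> F z = long_ray_zero"
    using continuous_map_paste_discrete[of X V E euclidean f long_ray_zero] f(1,3) by auto
  have FE: "F x = Abs_long_ray (r x, 0)" if "x \<in> E" for x
    using F(2)[OF that] f(2)[OF that] V(2) E(1) that by auto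
  have "\<not> bounded_wrt long_ray_segment (F ` D)"
  proof
    assume "bounded_wrt long_ray_segment (F ` D)"
    then obtain \<alpha> where \<alpha>: "F ` D \<subseteq> long_ray_segment \<alpha>"
      unfolding bounded_wrt_def by blast
    \<comment> \<open>The peak at \<open>x\<close> encodes its rank, so a bound for \<open>F\<close>
      on \<open>D\<close> is a bound for \<open>E\<close>.\<close>
    have "x \<in> U \<alpha>" if "x \<in> E" for x
    proof -
      have "F x \<in> long_ray_segment \<alpha>"
        using \<alpha> that E(1) by blast
      then have "r x < \<alpha>"
        using FE[OF that] by (simp add: long_ray_segment_def less_long_ray_def Rep_long_ray_Abs)
      then show ?thesis
        using r[of x] type_I_space_mono[OF assms(1) less_imp_le, of "r x" \<alpha>] that E(1) by blast
    qed
    then show False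
      using E(2) unfolding bounded_wrt_def by blast
  qed
  moreover have "club X U (D - E)"
    using closedin_subset_of_closed_discrete[OF clo disc, of "D - E"] E(3)
    by (simp add: club_def)
  ultimately have "\<not> F ` (D - E) \<subseteq> long_ray_segment \<alpha>" for \<alpha>
    using assms(4) F(1) unfolding direction_def bounded_wrt_def by blast
  moreover have "F y = long_ray_zero" if "y \<in> D - E" for y
  proof -
    \<comment> \<open>The point \<open>y\<close> lies in its own set \<open>V y\<close>, which is
      disjoint from \<open>V x\<close>.\<close>
    have "y \<notin> V x" if x: "x \<in> E" for x
    proof -
      have "x \<in> D" "y \<in> D" "x \<noteq> y"
        using x \<open>y \<in> D - E\<close> E(1) by auto
      then have "V x \<inter> V y = {}" "y \<in> V y"
        using V(2,3) by (simp_all add: disjoint_family_on_def)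
      then show ?thesis
        by blast
    qed
    then show ?thesis
      using F(3) by blast
  qed
  \<comment> \<open>The segment at the first ordinal is empty, so a strictly larger \<open>b\<close>
    is taken to capture the endpoint of the ray.\<close>
  moreover obtain b :: omega1 where "(LEAST \<alpha>. True) < b"
    using countable_omega1_bounded[of "{LEAST \<alpha>. True}"] by auto
  then have "long_ray_zero \<in> long_ray_segment b"
    by (simp add: long_ray_segment_def long_ray_zero_def less_long_ray_def Rep_long_ray_Abs)
  ultimately show False
    by (metis image_subsetI)
qed

end
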